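(* Any cell probe data structure with cell size $w$ bits solving the set disjointness problem over the universe $[n]$ with a memoryless update algorithm must have query time $t_q = \Omega(n/w)$, regardless of the preprocessing time, space usage and update time.
   Context: **Cell probe model.** A data structure consists of a collection of memory cells, each storing $w$ bits and each having an integer address in $[2^w]=\{1,\dots,2^w\}$. In a preprocessing phase the data structure receives an input and initializes its cells (with unrestricted computation). A query algorithm, given a query, probes (reads) cells one at a time; the cell probed at each step may depend arbitrarily on the query and the contents of all cells probed so far (so the query algorithm may be adaptive); after probing some cells it terminates with the answer. An update algorithm, given an update, reads and/or writes cells (both are called probing). Only probes are charged: the query time $t_q$ and update time $t_u$ are the (worst-case) numbers of cells probed when answering a query, respectively processing an update. The space usage is the largest address used. Data structures are deterministic and always correct. **Memoryless update algorithm.** The update algorithm is non-adaptive, i.e. the cells it probes when processing an update depend only on the update and not on the contents of previously probed cells; and furthermore the contents written to a cell during an update depend only on the update and the current contents of that cell (not on the contents of other cells probed during the update). **Set disjointness problem.** In a preprocessing phase, we receive a subset $S$ of a universe $[n]=\{1,\dots,n\}$. We then support updates inserting elements $x\in[n]$ into an initially empty set $T$. The problem has a single query, which asks to return whether $S\cap T=\emptyset$. **Asymptotics.** The $\Omega(\cdot)$ hides an absolute positive constant, independent of $n$, $w$ and the data structure. *)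

theory Defs
  imports Complex_Main
begin

section \<open>Dynamic data structure problems\<close>

text \<open>
  The correct answer to a query depends on the preprocessed input and on the sequence of updates
  performed so far (in chronological order).
\<close>

record ('i, 'u, 'q, 'r) dyn_problem =
  inputs :: "'i set"
  updates :: "'u set"
  queries :: "'q set"
  answer :: "'i \<Rightarrow> 'u list \<Rightarrow> 'q \<Rightarrow> 'r"

definition set_disjointness :: "nat \<Rightarrow> (nat set, nat, unit, bool) dyn_problem" where
  "set_disjointness n =
     \<lparr> inputs = Pow {1..n}, updates = {1..n}, queries = UNIV,
       answer = (\<lambda>S xs _. S \<inter> set xs = {}) \<rparr>"


section \<open>The cell probe model\<close>

type_synonym word = "bool list"
type_synonym memory = "nat \<Rightarrow> word"

definition words :: "nat \<Rightarrow> word set" where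
  "words w = {c. length c = w}"

definition addresses :: "nat \<Rightarrow> nat set" where
  "addresses w = {1..2 ^ w}"

text \<open>Values at natural numbers that are not addresses are irrelevant and left unconstrained.\<close>

definition memories :: "nat \<Rightarrow> memory set" where
  "memories w = {M. \<forall>a\<in>addresses w. M a \<in> words w}"

text \<open>
  An adaptive algorithm is a decision tree: the continuation after reading a cell is an arbitrary
  function of the contents found, so each step may depend on everything read before.
\<close>

datatype 'r query_tree =
    Answer 'r
  | Probe nat "word \<Rightarrow> 'r query_tree"

datatype update_tree =
    Done
  | Read nat "word \<Rightarrow> update_tree"
  | Write nat word update_tree

primrec run_query :: "'r query_tree \<Rightarrow> memory \<Rightarrow> 'r" where
  "run_query (Answer r) M = r"
| "run_query (Probe a k) M = run_query (k (M a)) M"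

primrec query_probes :: "'r query_tree \<Rightarrow> memory \<Rightarrow> nat" where
  "query_probes (Answer r) M = 0"
| "query_probes (Probe a k) M = Suc (query_probes (k (M a)) M)"

primrec wf_query :: "nat \<Rightarrow> 'r query_tree \<Rightarrow> bool" where
  "wf_query w (Answer r) \<longleftrightarrow> True"
| "wf_query w (Probe a k) \<longleftrightarrow> a \<in> addresses w \<and> (\<forall>c\<in>words w. wf_query w (k c))"

primrec run_update :: "update_tree \<Rightarrow> memory \<Rightarrow> memory" where
  "run_update Done M = M"
| "run_update (Read a k) M = run_update (k (M a)) M"
| "run_update (Write a c t) M = run_update t (M(a := c))"

primrec update_cells :: "update_tree \<Rightarrow> memory \<Rightarrow> nat set" where
  "update_cells Done M = {}"
| "update_cells (Read a k) M = insert a (update_cells (k (M a)) M)"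
| "update_cells (Write a c t) M = insert a (update_cells t (M(a := c)))"

primrec wf_update :: "nat \<Rightarrow> update_tree \<Rightarrow> bool" where
  "wf_update w Done \<longleftrightarrow> True"
| "wf_update w (Read a k) \<longleftrightarrow> a \<in> addresses w \<and> (\<forall>c\<in>words w. wf_update w (k c))"
| "wf_update w (Write a c t) \<longleftrightarrow> a \<in> addresses w \<and> c \<in> words w \<and> wf_update w t"

record ('i, 'u, 'q, 'r) data_structure =
  preprocess :: "'i \<Rightarrow> memory"
  update_alg :: "'u \<Rightarrow> update_tree"
  query_alg :: "'q \<Rightarrow> 'r query_tree"

definition cell_probe_structure ::
  "nat \<Rightarrow> ('i, 'u, 'q, 'r) dyn_problem \<Rightarrow> ('i, 'u, 'q, 'r) data_structure \<Rightarrow> bool" where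
  "cell_probe_structure w P D \<longleftrightarrow>
     (\<forall>i\<in>inputs P. preprocess D i \<in> memories w) \<and>
     (\<forall>u\<in>updates P. wf_update w (update_alg D u)) \<and>
     (\<forall>q\<in>queries P. wf_query w (query_alg D q))"

definition memory_after ::
  "('i, 'u, 'q, 'r) data_structure \<Rightarrow> 'i \<Rightarrow> 'u list \<Rightarrow> memory" where
  "memory_after D i us = fold (\<lambda>u. run_update (update_alg D u)) us (preprocess D i)"

definition solves ::
  "('i, 'u, 'q, 'r) data_structure \<Rightarrow> ('i, 'u, 'q, 'r) dyn_problem \<Rightarrow> bool" where
  "solves D P \<longleftrightarrow>
     (\<forall>i\<in>inputs P. \<forall>us\<in>lists (updates P). \<forall>q\<in>queries P.
        run_query (query_alg D q) (memory_after D i us) = answer P i us q)"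

text \<open>
  The worst case is over the memory states that actually arise from an input and a sequence of
  updates.  The maximum is over a finite set by \<open>finite_query_costs\<close> below, provided that there
  are finitely many queries.
\<close>

definition query_costs ::
  "('i, 'u, 'q, 'r) dyn_problem \<Rightarrow> ('i, 'u, 'q, 'r) data_structure \<Rightarrow> nat set" where
  "query_costs P D =
     {query_probes (query_alg D q) (memory_after D i us) | i us q.
        i \<in> inputs P \<and> us \<in> lists (updates P) \<and> q \<in> queries P}"

definition query_time ::
  "('i, 'u, 'q, 'r) dyn_problem \<Rightarrow> ('i, 'u, 'q, 'r) data_structure \<Rightarrow> nat" where
  "query_time P D = Max (query_costs P D)"


section \<open>Non-adaptive and memoryless updates\<close>

definition nonadaptive_updates ::
  "nat \<Rightarrow> ('i, 'u, 'q, 'r) dyn_problem \<Rightarrow> ('i, 'u, 'q, 'r) data_structure \<Rightarrow> bool" where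
  "nonadaptive_updates w P D \<longleftrightarrow>
     (\<exists>A. \<forall>u\<in>updates P. \<forall>M\<in>memories w. update_cells (update_alg D u) M = A u)"

text \<open>
  Cells that are not probed keep their contents, and a cell that is only read is regarded as
  rewritten with its current contents.  Hence the second conjunct constrains the new contents of
  all probed cells, which also prevents the decision whether to write from depending on other
  cells.
\<close>

definition memoryless_updates ::
  "nat \<Rightarrow> ('i, 'u, 'q, 'r) dyn_problem \<Rightarrow> ('i, 'u, 'q, 'r) data_structure \<Rightarrow> bool" where
  "memoryless_updates w P D \<longleftrightarrow>
     nonadaptive_updates w P D \<and>
     (\<exists>f. \<forall>u\<in>updates P. \<forall>M\<in>memories w. \<forall>a\<in>update_cells (update_alg D u) M.
        run_update (update_alg D u) M a = f u a (M a))"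


section \<open>The worst-case query time is well defined\<close>

lemma finite_words: "finite (words w)"
  using finite_lists_length_eq[of "UNIV :: bool set" w] by (simp add: words_def)

lemma run_update_memories:
  "wf_update w t \<Longrightarrow> M \<in> memories w \<Longrightarrow> run_update t M \<in> memories w"
proof (induction t arbitrary: M)
  case (Read a k)
  then have "M a \<in> words w" by (auto simp: memories_def)
  with Read show ?case by auto
next
  case (Write a c t)
  then have "M(a := c) \<in> memories w" by (auto simp: memories_def)
  with Write show ?case by auto
qed simp

lemma memory_after_memories:
  assumes "cell_probe_structure w P D" "i \<in> inputs P" "us \<in> lists (updates P)"
  shows "memory_after D i us \<in> memories w"
proof -
  have "fold (\<lambda>u. run_update (update_alg D u)) us M \<in> memories w" if "M \<in> memories w" for M
    using assms(3) that
  proof (induction us arbitrary: M)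
    case (Cons u us)
    then have "wf_update w (update_alg D u)"
      using assms(1) by (simp add: cell_probe_structure_def)
    with Cons show ?case by (simp add: run_update_memories)
  qed simp
  with assms(1,2) show ?thesis
    by (auto simp: memory_after_def cell_probe_structure_def)
qed

lemma query_probes_bounded:
  "wf_query w t \<Longrightarrow> \<exists>b. \<forall>M\<in>memories w. query_probes t M \<le> b"
proof (induction t)
  case (Probe a k)
  then have "\<forall>c\<in>words w. \<exists>b. \<forall>M\<in>memories w. query_probes (k c) M \<le> b" by auto
  then obtain b where b: "\<And>c M. c \<in> words w \<Longrightarrow> M \<in> memories w \<Longrightarrow> query_probes (k c) M \<le> b c"
    by metis
  have "query_probes (Probe a k) M \<le> Suc (\<Sum>c\<in>words w. b c)" if M: "M \<in> memories w" for M
  proof -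
    have c: "M a \<in> words w" using Probe.prems M by (auto simp: memories_def)
    have "query_probes (k (M a)) M \<le> b (M a)" using b c M by blast
    also have "\<dots> \<le> (\<Sum>c\<in>words w. b c)" using c finite_words by (intro member_le_sum) auto
    finally show ?thesis by simp
  qed
  then show ?case by blast
qed auto

lemma finite_query_costs:
  assumes "cell_probe_structure w P D" and "finite (queries P)"
  shows "finite (query_costs P D)"
proof -
  have "\<forall>q\<in>queries P. \<exists>b. \<forall>M\<in>memories w. query_probes (query_alg D q) M \<le> b"
    using assms(1) query_probes_bounded unfolding cell_probe_structure_def by blast
  then obtain b where
    b: "\<And>q M. q \<in> queries P \<Longrightarrow> M \<in> memories w \<Longrightarrow> query_probes (query_alg D q) M \<le> b q"
    by metis
  have "query_costs P D \<subseteq> (\<Union>q\<in>queries P. {..b q})"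
    using b memory_after_memories[OF assms(1)] unfolding query_costs_def by blast
  then show ?thesis by (rule finite_subset) (use assms(2) in auto)
qed

lemma query_costs_set_disjointness_nonempty: "query_costs (set_disjointness n) D \<noteq> {}"
proof -
  have "query_probes (query_alg D ()) (memory_after D {} []) \<in> query_costs (set_disjointness n) D"
    unfolding query_costs_def set_disjointness_def by force
  then show ?thesis by blast
qed

end

(*
  A fooling set argument.  Under memoryless updates the contents of a cell after inserting T depend
  on S only through the initial contents of that cell.  Record, for every probe of the query on
  (S, T), the contents of the probed cell before and after the insertions.  If (S, T) and (S', T')
  have the same record, then the query on the mixed pair (S, T') follows the same path and gives
  the same answer.  Since the pairs (S, complement of S) form a fooling set for disjointness, their
  2^n records are distinct, whereas t_q probes admit at most 2^(2 w t_q) records.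
*)

theory Submission
  imports Defs
begin

lemma card_words: "card (words w) = 2 ^ w"
  using card_lists_length_eq[of "UNIV :: bool set" w] by (simp add: words_def)

lemma run_update_unprobed: "a \<notin> update_cells t M \<Longrightarrow> run_update t M a = M a"
  by (induction t arbitrary: M) auto

text \<open>Non-adaptivity puts \<open>a\<close> on the same side of the probed set for both
  memories. If probed, its new contents are a function of \<open>u\<close>, \<open>a\<close> and its
  old contents; otherwise it is unchanged.\<close>

lemma memoryless_run_update_cong:
  assumes "memoryless_updates w P D" "u \<in> updates P"
    and "M \<in> memories w" "M' \<in> memories w" "M a = M' a"
  shows "run_update (update_alg D u) M a = run_update (update_alg D u) M' a"
proof -
  obtain A f where
    A: "\<forall>u\<in>updates P. \<forall>M\<in>memories w. update_cells (update_alg D u) M = A u" and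
    f: "\<forall>u\<in>updates P. \<forall>M\<in>memories w. \<forall>a\<in>update_cells (update_alg D u) M.
          run_update (update_alg D u) M a = f u a (M a)"
    using assms(1) unfolding memoryless_updates_def nonadaptive_updates_def by blast
  show ?thesis
  proof (cases "a \<in> A u")
    case True
    then show ?thesis using A f assms(2-) by simp
  next
    case False
    then show ?thesis using A assms(2-) by (simp add: run_update_unprobed)
  qed
qed

text \<open>Each cell evolves independently of the others, so the input can influence it only
  through its initial contents.\<close>

lemma memoryless_memory_after_cong:
  assumes D: "cell_probe_structure w P D" "memoryless_updates w P D"
    and "i \<in> inputs P" "j \<in> inputs P" "us \<in> lists (updates P)"
    and "preprocess D i a = preprocess D j a"
  shows "memory_after D i us a = memory_after D j us a"
  using assms(5)
proof (induction us rule: rev_induct)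
  case Nil
  show ?case using assms(6) by (simp add: memory_after_def)
next
  case (snoc u us)
  then have us: "us \<in> lists (updates P)" and u: "u \<in> updates P" by auto
  have "run_update (update_alg D u) (memory_after D i us) a =
        run_update (update_alg D u) (memory_after D j us) a"
    using memoryless_run_update_cong[OF D(2) u] memory_after_memories[OF D(1) _ us]
      snoc.IH[OF us] assms(3,4) by blast
  then show ?case by (simp add: memory_after_def)
qed

text \<open>Only \<open>M\<close> steers the path; the contents in \<open>M0\<close> are recorded
  but never influence it.\<close>

primrec transcript :: "'r query_tree \<Rightarrow> memory \<Rightarrow> memory \<Rightarrow> (word \<times> word) list" where
  "transcript (Answer r) M0 M = []"
| "transcript (Probe a k) M0 M = (M0 a, M a) # transcript (k (M a)) M0 M"

lemma length_transcript: "length (transcript t M0 M) = query_probes t M"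
  by (induction t) auto

lemma set_transcript:
  assumes "wf_query w t" "M0 \<in> memories w" "M \<in> memories w"
  shows "set (transcript t M0 M) \<subseteq> words w \<times> words w"
  using assms by (induction t) (auto simp: memories_def)

text \<open>
  Transcripts for a fixed tree are prefix-free, so that equality of arbitrary extensions suffices;
  this allows padding all of them to the same length.
\<close>

lemma run_query_transcript_cong:
  assumes "transcript t M0 M @ xs = transcript t M0' M' @ ys"
    and "\<And>a. M0 a = M0' a \<Longrightarrow> N a = M' a"
  shows "run_query t N = run_query t M'"
  using assms by (induction t) auto

lemma set_disjointness_query_time:
  fixes D :: "(nat set, nat, unit, bool) data_structure"
  assumes D: "cell_probe_structure w (set_disjointness n) D"
    and sol: "solves D (set_disjointness n)"
    and mem: "memoryless_updates w (set_disjointness n) D"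
  shows "n \<le> 2 * w * query_time (set_disjointness n) D"
proof -
  define P where "P = set_disjointness n"
  note D = D[folded P_def] and sol = sol[folded P_def] and mem = mem[folded P_def]
  have P: "inputs P = Pow {1..n}" "updates P = {1..n}" "queries P = UNIV"
    "answer P S xs q \<longleftrightarrow> S \<inter> set xs = {}" for S xs q
    by (simp_all add: P_def set_disjointness_def)
  define t where "t = query_alg D ()"
  define tq where "tq = query_time P D"
  define ins where "ins S = sorted_list_of_set ({1..n} - S)" for S
  have set_ins: "set (ins S) = {1..n} - S" for S by (simp add: ins_def)
  then have ins: "ins S \<in> lists (updates P)" for S by (auto simp: P)
  define tr where "tr S = transcript t (preprocess D S) (memory_after D S (ins S))" for S
  \<comment> \<open>The padding consists of pairs of \<open>w\<close>-bit words, so that codes can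
    be counted as lists of length exactly \<open>tq\<close>.\<close>
  define code where "code S = tr S @ replicate (tq - length (tr S)) (replicate w False, replicate w False)"
    for S
  have answer: "run_query t (memory_after D S (ins T)) \<longleftrightarrow> S \<inter> ({1..n} - T) = {}"
    if "S \<in> inputs P" for S T
    using sol that ins[of T] set_ins[of T] P unfolding solves_def t_def by simp
  have "code S \<in> {xs. set xs \<subseteq> words w \<times> words w \<and> length xs = tq}" if S: "S \<in> inputs P" for S
  proof -
    have "query_probes t (memory_after D S (ins S)) \<in> query_costs P D"
      using S ins unfolding query_costs_def t_def P(3) by blast
    moreover have "finite (query_costs P D)" using finite_query_costs[OF D] P(3) by simp
    ultimately have "length (tr S) \<le> tq"
      by (simp add: tr_def length_transcript tq_def query_time_def)
    moreover have "set (tr S) \<subseteq> words w \<times> words w"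
      using D S memory_after_memories[OF D S ins] P(3) unfolding tr_def t_def
      by (intro set_transcript) (auto simp: cell_probe_structure_def)
    ultimately show ?thesis by (auto simp: code_def words_def)
  qed
  moreover have "S \<subseteq> T" if "S \<in> inputs P" "T \<in> inputs P" "code S = code T" for S T
  proof -
    \<comment> \<open>The mixed memory agrees with that of \<open>T\<close> on every cell where the
      two preprocessed memories agree, and equal codes force this agreement on all cells probed for
      \<open>T\<close>.\<close>
    have "run_query t (memory_after D S (ins T)) = run_query t (memory_after D T (ins T))"
      using that(3) memoryless_memory_after_cong[OF D mem that(1,2) ins] unfolding code_def tr_def
      by (rule run_query_transcript_cong)
    \<comment> \<open>The query on \<open>T\<close> and its complement reports disjointness, hence
      so does the mixed one. Exchanging \<open>S\<close> and \<open>T\<close> then gives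
      injectivity.\<close>
    then have "S \<inter> ({1..n} - T) = {}" using answer that by auto
    then show ?thesis using that(1) by (auto simp: P)
  qed
  then have "inj_on code (inputs P)" by (intro inj_onI subset_antisym) metis+
  moreover have fin: "finite (words w \<times> words w)" by (simp add: finite_words)
  ultimately have "card (inputs P) \<le> card {xs. set xs \<subseteq> words w \<times> words w \<and> length xs = tq}"
    by (intro card_inj_on_le[of code] finite_lists_length_eq) auto
  then have "(2::nat) ^ n \<le> (2 ^ w * 2 ^ w) ^ tq"
    by (simp add: P card_Pow card_lists_length_eq[OF fin] card_cartesian_product card_words)
  also have "\<dots> = 2 ^ (2 * w * tq)" by (simp add: power_mult mult_2 power_add)
  finally have "n \<le> 2 * w * tq" by (rule power_le_imp_le_exp[rotated]) simp
  then show ?thesis by (simp add: tq_def P_def)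
qed

theorem theorem2:
  "\<exists>c::real. c > 0 \<and>
     (\<forall>(n::nat) (w::nat) (D :: (nat set, nat, unit, bool) data_structure).
        w \<ge> 1 \<longrightarrow>
        cell_probe_structure w (set_disjointness n) D \<longrightarrow>
        solves D (set_disjointness n) \<longrightarrow>
        memoryless_updates w (set_disjointness n) D \<longrightarrow>
        real (query_time (set_disjointness n) D) \<ge> c * (real n / real w))"
\<comment> \<open>The constant is 1/2 because each probe contributes two words to the transcript,
  \<open>2 * w\<close> bits in all.\<close>
proof (intro exI[of _ "1/2"] conjI allI impI)
  fix n w :: nat and D :: "(nat set, nat, unit, bool) data_structure"
  assume w: "w \<ge> 1" and "cell_probe_structure w (set_disjointness n) D"
    "solves D (set_disjointness n)" "memoryless_updates w (set_disjointness n) D"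
  then have "real n \<le> real (2 * w * query_time (set_disjointness n) D)"
    using set_disjointness_query_time by (simp only: of_nat_le_iff)
  with w show "1 / 2 * (real n / real w) \<le> real (query_time (set_disjointness n) D)"
    by (simp add: field_simps)
qed simp

end
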